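(* Let $d\ge 3$ and $\gamma\in(-d,-2)$. Fix a non-negative $f\in L^1(\mathbb{R}^d)$, and let $$h[f](v)=C(d,d+\gamma)\int_{\mathbb{R}^d}|v-v_*|^{\gamma}f(v_* )\,dv_*,\qquad a[f](v)=c_{d,\gamma}\int_{\mathbb{R}^d}|v-v_*|^{2+\gamma}f(v_* )\,dv_*.$$ Then for all $\phi\in C^1_c(\mathbb{R}^d)$ (and limits of such functions), $$(d+\gamma)\int_{\mathbb{R}^d}h[f]\,\phi^2\,dv\le 4\int_{\mathbb{R}^d}a[f]\,|\nabla\phi|^2\,dv.$$
   Context: The constants are $C(d,\alpha)=\pi^{-d/2}2^{-\alpha}\frac{\Gamma((d-\alpha)/2)}{\Gamma(\alpha/2)}$ for $0<\alpha<d$, and $c_{d,\gamma}=\frac{C(d,d+\gamma)}{d+\gamma}$. *)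

theory Defs
  imports "HOL-Analysis.Analysis"
begin

text \<open>
  Euclidean space of dimension \<open>d\<close> is a type \<open>'a :: euclidean_space\<close> with \<open>d = DIM('a)\<close>.
  All integrands are non-negative, so integrals are taken in \<open>[0, \<infinity>]\<close>: no value is replaced
  by 0 for lack of integrability.
\<close>

definition riesz_C :: "nat \<Rightarrow> real \<Rightarrow> real" where
  "riesz_C d \<alpha> = pi powr (- (real d / 2)) * 2 powr (- \<alpha>) *
     (Gamma ((real d - \<alpha>) / 2) / Gamma (\<alpha> / 2))"

definition landau_c :: "nat \<Rightarrow> real \<Rightarrow> real" where
  "landau_c d \<gamma> = riesz_C d (real d + \<gamma>) / (real d + \<gamma>)"

text \<open>
  For \<open>- d < \<gamma> < 0\<close> both constants are positive, hence unaffected by \<open>ennreal\<close>. The convention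
  \<open>0 powr s = 0\<close> only concerns the null set \<open>w = v\<close>.
\<close>

definition h_pot :: "real \<Rightarrow> ('a::euclidean_space \<Rightarrow> real) \<Rightarrow> 'a \<Rightarrow> ennreal" where
  "h_pot \<gamma> f v = ennreal (riesz_C DIM('a) (real DIM('a) + \<gamma>)) *
     (\<integral>\<^sup>+ w. ennreal (norm (v - w) powr \<gamma> * f w) \<partial>lborel)"

definition a_pot :: "real \<Rightarrow> ('a::euclidean_space \<Rightarrow> real) \<Rightarrow> 'a \<Rightarrow> ennreal" where
  "a_pot \<gamma> f v = ennreal (landau_c DIM('a) \<gamma>) *
     (\<integral>\<^sup>+ w. ennreal (norm (v - w) powr (2 + \<gamma>) * f w) \<partial>lborel)"

definition grad :: "('a::euclidean_space \<Rightarrow> real) \<Rightarrow> 'a \<Rightarrow> 'a" where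
  "grad \<phi> x = (THE D. GDERIV \<phi> x :> D)"

definition C1_compact_support :: "('a::euclidean_space \<Rightarrow> real) \<Rightarrow> bool" where
  "C1_compact_support \<phi> \<longleftrightarrow>
     (\<forall>x. \<phi> differentiable (at x)) \<and> continuous_on UNIV (grad \<phi>) \<and>
     compact (closure {x. \<phi> x \<noteq> 0})"

text \<open>
  \<open>\<phi>\<close> is a limit of \<open>C\<^sup>1\<close> functions with compact support and \<open>G\<close> is its gradient: \<open>(\<phi>, G)\<close>
  lies in the closure of the graph of the gradient, with gradients converging in the weighted
  space \<open>L\<^sup>2(a[f] dv)\<close>. Almost everywhere convergence of the functions covers convergence in
  any (weighted, local) \<open>L\<^sup>p\<close>, by passing to a subsequence. If \<open>f\<close> is not a.e. 0,
  then \<open>a[f]\<close> is bounded below by a positive constant on every ball, so the convergence of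
  gradients is also one in \<open>L\<^sup>2\<close> on every ball and \<open>G\<close> is the weak gradient of \<open>\<phi>\<close>.
\<close>

definition C1_compact_support_limit ::
  "real \<Rightarrow> ('a::euclidean_space \<Rightarrow> real) \<Rightarrow> ('a \<Rightarrow> real) \<Rightarrow> ('a \<Rightarrow> 'a) \<Rightarrow> bool" where
  "C1_compact_support_limit \<gamma> f \<phi> G \<longleftrightarrow>
     \<phi> \<in> borel_measurable borel \<and> G \<in> borel_measurable borel \<and>
     (\<exists>\<psi> :: nat \<Rightarrow> 'a \<Rightarrow> real.
        (\<forall>n. C1_compact_support (\<psi> n)) \<and>
        (AE v in lborel. (\<lambda>n. \<psi> n v) \<longlonglongrightarrow> \<phi> v) \<and>
        (\<lambda>n. \<integral>\<^sup>+ v. a_pot \<gamma> f v * ennreal ((norm (grad (\<psi> n) v - G v))\<^sup>2) \<partial>lborel)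
          \<longlonglongrightarrow> 0)"

end

theory Submission
  imports Defs
begin

text \<open>
  By Tonelli it suffices to prove, for each fixed \<open>w\<close>, the Hardy inequality
  \<open>(d + \<gamma>)\<^sup>2 \<integral> |v - w|\<^sup>\<gamma> \<phi>\<^sup>2 dv \<le> 4 \<integral> |v - w|\<^bsup>\<gamma> + 2\<^esup> |\<nabla>\<phi>|\<^sup>2 dv\<close>. Instead of integrating by parts
  in \<open>\<real>\<^sup>d\<close>, one bounds \<open>\<phi>(x)\<^sup>2\<close> along the ray \<open>s \<mapsto> s x\<close>, \<open>s \<ge> 1\<close>, by a one-dimensional weighted
  inequality and integrates in \<open>x\<close>: by scaling, every \<open>s\<close> contributes a power of \<open>s\<close> times
  the same gradient integral. The passage to limits is Fatou's lemma.
\<close>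

section \<open>A weighted inequality on a half-line\<close>

text \<open>Completing the square: \<open>s powr (e - 1) * (s * u' s + e * u s)\<^sup>2\<close> is
  non-negative and equals the integrand on the right plus \<open>e\<close> times the derivative of
  \<open>s powr e * (u s)\<^sup>2\<close>. Integrating that derivative from 1 to a point where
  \<open>u\<close> vanishes leaves only the boundary term at 1.\<close>

lemma weighted_ray_inequality:
  fixes u u' :: "real \<Rightarrow> real"
  assumes "e > 0"
    and der: "\<And>s. s \<ge> 1 \<Longrightarrow> (u has_real_derivative u' s) (at s)"
    and cont: "continuous_on {1..} u'"
    and van: "\<And>s. s \<ge> R \<Longrightarrow> u s = 0"
  shows "ennreal (e * (u 1)\<^sup>2)
    \<le> (\<integral>\<^sup>+ s. indicator {1..} s * ennreal (s powr (e + 1) * (u' s)\<^sup>2) \<partial>lborel)"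
proof -
  \<comment> \<open>\<open>T \<ge> 1\<close> keeps the interval \<open>{1..T}\<close> non-empty, and
    \<open>T \<ge> R\<close> kills the boundary term at \<open>T\<close>. \<open>D\<close> is the
    derivative of \<open>s powr e * (u s)\<^sup>2\<close>, and \<open>K\<close> is the integrand of
    the claim.\<close>
  define T where "T = max 1 R"
  define D where "D s = e * s powr (e - 1) * (u s)\<^sup>2 + s powr e * (2 * u s * u' s)" for s
  define K where "K s = s powr (e + 1) * (u' s)\<^sup>2" for s
  have "(D has_integral T powr e * (u T)\<^sup>2 - 1 powr e * (u 1)\<^sup>2) {1..T}"
  proof (rule fundamental_theorem_of_calculus)
    fix s assume "s \<in> {1..T}"
    then have "((\<lambda>s. s powr e * (u s)\<^sup>2) has_real_derivative D s) (at s)"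
      unfolding D_def by (auto intro!: derivative_eq_intros der simp: algebra_simps)
    then show "((\<lambda>s. s powr e * (u s)\<^sup>2) has_vector_derivative D s) (at s within {1..T})"
      by (simp add: has_real_derivative_iff_has_vector_derivative has_vector_derivative_at_within)
  qed (simp add: T_def)
  moreover have "u T = 0" by (simp add: van T_def)
  ultimately have "(D has_integral - (u 1)\<^sup>2) {1..T}" by simp
  from has_integral_mult_right[OF this, of "- e"]
  have D: "((\<lambda>s. - e * D s) has_integral e * (u 1)\<^sup>2) {1..T}" by simp
  have "continuous_on {1..T} K"
    unfolding K_def by (intro continuous_intros continuous_on_subset[OF cont]) auto
  then have K: "(K has_integral integral {1..T} K) {1..T}"
    using integrable_continuous_real integrable_integral by blast
  have "e * (u 1)\<^sup>2 \<le> integral {1..T} K"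
  proof (rule has_integral_le[OF D K])
    fix s assume "s \<in> {1..T}"
    then have "s > 0" by simp
    then have "K s + e * D s = s powr (e - 1) * (s * u' s + e * u s)\<^sup>2"
      by (simp add: K_def D_def powr_add powr_diff power2_eq_square field_simps)
    then have "K s + e * D s \<ge> 0" by simp
    then show "- e * D s \<le> K s" by simp
  qed
  then have "ennreal (e * (u 1)\<^sup>2) \<le> (\<integral>\<^sup>+ s. ennreal (indicator {1..T} s * K s) \<partial>lborel)"
    using nn_integral_has_integral_lebesgue[OF _ K] by (simp add: K_def ennreal_leI)
  also have "\<dots> \<le> (\<integral>\<^sup>+ s. indicator {1..} s * ennreal (K s) \<partial>lborel)"
    by (intro nn_integral_mono) (auto split: split_indicator)
  finally show ?thesis by (simp add: K_def)
qed

section \<open>Integrals under translation and dilation\<close>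

text \<open>One change of variables for two uses: \<open>t = 0\<close> gives the dilation along
  rays, \<open>c = 1\<close> the translation that moves the singularity to the origin.\<close>

lemma nn_integral_lborel_affine:
  fixes g :: "'a::euclidean_space \<Rightarrow> ennreal"
  assumes [measurable]: "g \<in> borel_measurable borel" and "c \<noteq> 0"
  shows "(\<integral>\<^sup>+ x. g x \<partial>lborel)
    = ennreal (\<bar>c\<bar> ^ DIM('a)) * (\<integral>\<^sup>+ x. g (t + c *\<^sub>R x) \<partial>lborel)"
  by (subst lborel_affine[OF \<open>c \<noteq> 0\<close>, of t])
    (simp add: nn_integral_density nn_integral_distr nn_integral_cmult)

text \<open>Substituting \<open>y = s *\<^sub>R x\<close>, the homogeneous weight contributes
  \<open>s powr (- p)\<close> and the Jacobian contributes \<open>s\<close> to the power minus the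
  dimension.\<close>

lemma nn_integral_dilated_powr:
  fixes g :: "'a::euclidean_space \<Rightarrow> ennreal"
  assumes [measurable]: "g \<in> borel_measurable borel" and "s > 0"
  shows "(\<integral>\<^sup>+ x. ennreal (norm x powr p) * g (s *\<^sub>R x) \<partial>lborel)
    = ennreal (s powr (- p - DIM('a))) * (\<integral>\<^sup>+ x. ennreal (norm x powr p) * g x \<partial>lborel)"
proof -
  have "(\<integral>\<^sup>+ x. ennreal (norm x powr p) * g x \<partial>lborel)
     = ennreal (s ^ DIM('a)) * (\<integral>\<^sup>+ x. ennreal (norm (s *\<^sub>R x) powr p) * g (s *\<^sub>R x) \<partial>lborel)"
    using \<open>s > 0\<close> by (subst nn_integral_lborel_affine[of _ s 0]) auto
  also have "(\<integral>\<^sup>+ x. ennreal (norm (s *\<^sub>R x) powr p) * g (s *\<^sub>R x) \<partial>lborel)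
     = ennreal (s powr p) * (\<integral>\<^sup>+ x. ennreal (norm x powr p) * g (s *\<^sub>R x) \<partial>lborel)"
    using \<open>s > 0\<close>
    by (subst nn_integral_cmult[symmetric])
      (auto simp: powr_mult ennreal_mult mult.assoc intro!: nn_integral_cong)
  finally show ?thesis
    using \<open>s > 0\<close>
    by (simp add: mult.assoc[symmetric] ennreal_mult[symmetric] powr_realpow[symmetric]
        powr_add[symmetric])
qed

lemma nn_integral_powr_atLeast_one:
  assumes "e > (0::real)"
  shows "(\<integral>\<^sup>+ s. indicator {1..} s * ennreal (s powr (- e - 1)) \<partial>lborel) = ennreal (1 / e)"
proof -
  have "((\<lambda>s. - (1 / e) * s powr (- e)) \<longlongrightarrow> - (1 / e) * 0) at_top"
    using assms by (intro tendsto_intros tendsto_neg_powr filterlim_ident) auto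
  then have "(\<integral>\<^sup>+ s. ennreal (s powr (- e - 1)) * indicator {1..} s \<partial>lborel)
      = ennreal (- (1 / e) * 0 - (- (1 / e) * 1 powr (- e)))"
    using assms by (intro nn_integral_FTC_atLeast) (auto intro!: derivative_eq_intros)
  then show ?thesis by (simp add: mult.commute)
qed

section \<open>The weighted Hardy inequality with singularity at the origin\<close>

lemma hardy_weighted:
  fixes \<phi> :: "'a::euclidean_space \<Rightarrow> real" and G :: "'a \<Rightarrow> 'a"
  assumes "real DIM('a) + \<gamma> > 0"
    and der: "\<And>x. GDERIV \<phi> x :> G x"
    and cont: "continuous_on UNIV G"
    and bdd: "bounded {x. \<phi> x \<noteq> 0}"
  shows "ennreal ((real DIM('a) + \<gamma>)\<^sup>2) * (\<integral>\<^sup>+ x. ennreal (norm x powr \<gamma> * (\<phi> x)\<^sup>2) \<partial>lborel)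
    \<le> 4 * (\<integral>\<^sup>+ x. ennreal (norm x powr (2 + \<gamma>) * (norm (G x))\<^sup>2) \<partial>lborel)"
proof -
  \<comment> \<open>For a free exponent \<open>e\<close> between 0 and
    \<open>k = d + \<gamma>\<close>, the argument bounds \<open>e * (k - e)\<close> times the
    integral on the left by the gradient integral. Half of \<open>k\<close> maximizes this factor
    and gives \<open>k\<^sup>2 / 4\<close>.\<close>
  define e where "e = (real DIM('a) + \<gamma>) / 2"
  have "e > 0" using assms(1) by (simp add: e_def)
  have [measurable]: "G \<in> borel_measurable borel"
    using cont by (rule borel_measurable_continuous_onI)
  have "continuous_on UNIV \<phi>"
    using der unfolding gderiv_def
    by (meson continuous_at_imp_continuous_on has_derivative_continuous)
  then have [measurable]: "\<phi> \<in> borel_measurable borel"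
    by (rule borel_measurable_continuous_onI)
  obtain B where B: "\<And>x. \<phi> x \<noteq> 0 \<Longrightarrow> norm x \<le> B"
    using bdd by (auto simp: bounded_iff)
  define M where "M = (\<integral>\<^sup>+ x. ennreal (norm x powr (2 + \<gamma>) * (norm (G x))\<^sup>2) \<partial>lborel)"
  have pointwise: "ennreal e * ennreal (norm x powr \<gamma> * (\<phi> x)\<^sup>2)
      \<le> (\<integral>\<^sup>+ s. indicator {1..} s * ennreal (s powr (e + 1)) *
          (ennreal (norm x powr (2 + \<gamma>)) * ennreal ((norm (G (s *\<^sub>R x)))\<^sup>2)) \<partial>lborel)" for x
  \<comment> \<open>There is no ray through \<open>x = 0\<close>; there the left side is 0 because
    \<open>0 powr \<gamma> = 0\<close>.\<close>
  proof (cases "x = 0")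
    case False
    have "ennreal (e * (\<phi> (1 *\<^sub>R x))\<^sup>2)
      \<le> (\<integral>\<^sup>+ s. indicator {1..} s * ennreal (s powr (e + 1) * (x \<bullet> G (s *\<^sub>R x))\<^sup>2) \<partial>lborel)"
    \<comment> \<open>Beyond this \<open>R\<close> the point \<open>s *\<^sub>R x\<close> has norm
      at least \<open>\<bar>B\<bar> + 1\<close>, hence lies outside the ball of radius
      \<open>B\<close> that contains all points where \<open>\<phi>\<close> is nonzero.\<close>
    proof (rule weighted_ray_inequality[where R = "(\<bar>B\<bar> + 1) / norm x"])
      fix s :: real
      have "(\<phi> has_derivative (\<lambda>h. h \<bullet> G (s *\<^sub>R x))) (at (s *\<^sub>R x))"
        using der by (simp add: gderiv_def)
      moreover have "((\<lambda>s. s *\<^sub>R x) has_derivative (\<lambda>h. h *\<^sub>R x)) (at s)"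
        by (auto intro!: derivative_eq_intros)
      ultimately have "((\<lambda>s. \<phi> (s *\<^sub>R x)) has_derivative (\<lambda>h. (h *\<^sub>R x) \<bullet> G (s *\<^sub>R x))) (at s)"
        by (rule has_derivative_compose[rotated])
      then show "((\<lambda>s. \<phi> (s *\<^sub>R x)) has_real_derivative x \<bullet> G (s *\<^sub>R x)) (at s)"
        by (simp add: has_field_derivative_def mult.commute[of _ "x \<bullet> G (s *\<^sub>R x)"])
    next
      show "continuous_on {1..} (\<lambda>s. x \<bullet> G (s *\<^sub>R x))"
        by (intro continuous_intros continuous_on_compose2[OF cont]) auto
    next
      fix s assume "s \<ge> (\<bar>B\<bar> + 1) / norm x"
      then have "\<bar>B\<bar> + 1 \<le> s * norm x" using False by (simp add: field_simps)
      also have "\<dots> \<le> norm (s *\<^sub>R x)" by (simp add: mult_right_mono)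
      finally have "norm (s *\<^sub>R x) > B" by simp
      then show "\<phi> (s *\<^sub>R x) = 0" using B[of "s *\<^sub>R x"] by linarith
    qed (fact \<open>e > 0\<close>)
    then have "ennreal (norm x powr \<gamma>) * ennreal (e * (\<phi> x)\<^sup>2)
      \<le> ennreal (norm x powr \<gamma>) *
         (\<integral>\<^sup>+ s. indicator {1..} s * ennreal (s powr (e + 1) * (x \<bullet> G (s *\<^sub>R x))\<^sup>2) \<partial>lborel)"
      by (intro mult_left_mono) auto
    also have "\<dots> = (\<integral>\<^sup>+ s. ennreal (norm x powr \<gamma>) *
         (indicator {1..} s * ennreal (s powr (e + 1) * (x \<bullet> G (s *\<^sub>R x))\<^sup>2)) \<partial>lborel)"
      by (rule nn_integral_cmult[symmetric]) measurable
    also have "\<dots> \<le> (\<integral>\<^sup>+ s. indicator {1..} s * ennreal (s powr (e + 1)) *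
          (ennreal (norm x powr (2 + \<gamma>)) * ennreal ((norm (G (s *\<^sub>R x)))\<^sup>2)) \<partial>lborel)"
    proof (rule nn_integral_mono)
      fix s :: real
      \<comment> \<open>Cauchy-Schwarz replaces the derivative along the ray by the full gradient.
        The resulting factor \<open>(norm x)\<^sup>2\<close> raises the weight from exponent
        \<gamma> to \<open>2 + \<gamma>\<close>.\<close>
      have "(x \<bullet> G (s *\<^sub>R x))\<^sup>2 \<le> (norm x)\<^sup>2 * (norm (G (s *\<^sub>R x)))\<^sup>2"
        using Cauchy_Schwarz_ineq[of x "G (s *\<^sub>R x)"] by (simp add: power2_norm_eq_inner)
      then have "norm x powr \<gamma> * (s powr (e + 1) * (x \<bullet> G (s *\<^sub>R x))\<^sup>2)
        \<le> norm x powr \<gamma> * (s powr (e + 1) * ((norm x)\<^sup>2 * (norm (G (s *\<^sub>R x)))\<^sup>2))"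
        by (intro mult_left_mono) auto
      also have "\<dots> = s powr (e + 1) * (norm x powr (2 + \<gamma>) * (norm (G (s *\<^sub>R x)))\<^sup>2)"
        using False by (simp add: powr_add powr_numeral)
      finally show "ennreal (norm x powr \<gamma>) *
         (indicator {1..} s * ennreal (s powr (e + 1) * (x \<bullet> G (s *\<^sub>R x))\<^sup>2))
        \<le> indicator {1..} s * ennreal (s powr (e + 1)) *
          (ennreal (norm x powr (2 + \<gamma>)) * ennreal ((norm (G (s *\<^sub>R x)))\<^sup>2))"
        by (auto simp: ennreal_mult[symmetric] ennreal_leI split: split_indicator)
    qed
    finally show ?thesis
      using \<open>e > 0\<close> by (simp add: ennreal_mult[symmetric] mult.left_commute)
  qed simp
  have "ennreal e * (\<integral>\<^sup>+ x. ennreal (norm x powr \<gamma> * (\<phi> x)\<^sup>2) \<partial>lborel)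
      = (\<integral>\<^sup>+ x. ennreal e * ennreal (norm x powr \<gamma> * (\<phi> x)\<^sup>2) \<partial>lborel)"
    by (rule nn_integral_cmult[symmetric]) measurable
  also have "\<dots> \<le> (\<integral>\<^sup>+ x. \<integral>\<^sup>+ s. indicator {1..} s * ennreal (s powr (e + 1)) *
      (ennreal (norm x powr (2 + \<gamma>)) * ennreal ((norm (G (s *\<^sub>R x)))\<^sup>2)) \<partial>lborel \<partial>lborel)"
    by (intro nn_integral_mono pointwise)
  \<comment> \<open>Tonelli: with \<open>s\<close> fixed, the inner integral over \<open>x\<close>
    is a dilated copy of \<open>M\<close>.\<close>
  also have "\<dots> = (\<integral>\<^sup>+ s. \<integral>\<^sup>+ x. indicator {1..} s * ennreal (s powr (e + 1)) *
      (ennreal (norm x powr (2 + \<gamma>)) * ennreal ((norm (G (s *\<^sub>R x)))\<^sup>2)) \<partial>lborel \<partial>lborel)"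
    by (rule lborel_pair.Fubini') measurable
  \<comment> \<open>The dilation contributes the exponent \<open>- (2 + \<gamma>) - d\<close> and
    the ray weight contributes \<open>e + 1\<close>. Since \<open>2 * e = d + \<gamma>\<close>, they
    add up to \<open>- e - 1\<close>, which is integrable at infinity.\<close>
  also have "\<dots> = (\<integral>\<^sup>+ s. M * (indicator {1..} s * ennreal (s powr (- e - 1))) \<partial>lborel)"
  proof (rule nn_integral_cong)
    fix s :: real
    show "(\<integral>\<^sup>+ x. indicator {1..} s * ennreal (s powr (e + 1)) *
        (ennreal (norm x powr (2 + \<gamma>)) * ennreal ((norm (G (s *\<^sub>R x)))\<^sup>2)) \<partial>lborel)
      = M * (indicator {1..} s * ennreal (s powr (- e - 1)))"
    proof (cases "s \<ge> 1")
      case True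
      have "e + 1 + (- (2 + \<gamma>) - DIM('a)) = - e - 1" by (simp add: e_def field_simps)
      then have "ennreal (s powr (e + 1)) * ennreal (s powr (- (2 + \<gamma>) - DIM('a)))
          = ennreal (s powr (- e - 1))"
        by (simp only: ennreal_mult[symmetric] powr_ge_zero powr_add[symmetric])
      moreover have "(\<integral>\<^sup>+ x. ennreal (norm x powr (2 + \<gamma>)) * ennreal ((norm (G (s *\<^sub>R x)))\<^sup>2)
          \<partial>lborel) = ennreal (s powr (- (2 + \<gamma>) - DIM('a))) * M"
        using True unfolding M_def
        by (subst nn_integral_dilated_powr[where g = "\<lambda>y. ennreal ((norm (G y))\<^sup>2)"])
          (auto simp: ennreal_mult)
      ultimately show ?thesis
        using True by (simp add: nn_integral_cmult) (metis mult.assoc mult.commute)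
    qed simp
  qed
  also have "\<dots> = M * ennreal (1 / e)"
    by (subst nn_integral_cmult) (simp_all add: nn_integral_powr_atLeast_one[OF \<open>e > 0\<close>])
  \<comment> \<open>Multiplying by \<open>4 * e\<close> clears the factor \<open>1 / e\<close>
    without a division in \<open>ennreal\<close>, where the integrals may be infinite.\<close>
  finally have "ennreal (4 * e) *
      (ennreal e * (\<integral>\<^sup>+ x. ennreal (norm x powr \<gamma> * (\<phi> x)\<^sup>2) \<partial>lborel))
    \<le> ennreal (4 * e) * (M * ennreal (1 / e))"
    by (rule mult_left_mono) simp
  also have "\<dots> = M * (ennreal (4 * e) * ennreal (1 / e))"
    by (simp add: mult_ac)
  also have "ennreal (4 * e) * ennreal (1 / e) = 4"
    using \<open>e > 0\<close> by (simp add: ennreal_mult[symmetric])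
  also have "ennreal (4 * e) *
      (ennreal e * (\<integral>\<^sup>+ x. ennreal (norm x powr \<gamma> * (\<phi> x)\<^sup>2) \<partial>lborel))
    = ennreal ((real DIM('a) + \<gamma>)\<^sup>2) * (\<integral>\<^sup>+ x. ennreal (norm x powr \<gamma> * (\<phi> x)\<^sup>2) \<partial>lborel)"
  proof -
    have "4 * e * e = (real DIM('a) + \<gamma>)\<^sup>2" by (simp add: e_def power2_eq_square field_simps)
    then have "ennreal (4 * e) * ennreal e = ennreal ((real DIM('a) + \<gamma>)\<^sup>2)"
      using \<open>e > 0\<close> by (simp add: ennreal_mult[symmetric])
    then show ?thesis by (simp only: mult.assoc[symmetric])
  qed
  finally show ?thesis by (simp add: M_def mult.commute)
qed

section \<open>Gradients, and the Hardy inequality with arbitrary centre\<close>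

text \<open>Since \<open>grad\<close> is a definite description, both existence and uniqueness are
  required. The vector representing the derivative \<open>F\<close> as an inner product has the
  coordinates \<open>F b\<close>, and it is unique because the Frechet derivative is.\<close>

lemma GDERIV_grad:
  fixes \<phi> :: "'a::euclidean_space \<Rightarrow> real"
  assumes "\<phi> differentiable (at x)"
  shows "GDERIV \<phi> x :> grad \<phi> x"
proof -
  obtain F where F: "(\<phi> has_derivative F) (at x)"
    using assms by (auto simp: differentiable_def)
  interpret F: bounded_linear F using F by (rule has_derivative_bounded_linear)
  have "F h = h \<bullet> (\<Sum>b\<in>Basis. F b *\<^sub>R b)" for h
  proof -
    have "F h = F (\<Sum>b\<in>Basis. (h \<bullet> b) *\<^sub>R b)" by (simp add: euclidean_representation)
    then show ?thesis by (simp add: F.sum F.scaleR inner_sum_right mult.commute)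
  qed
  then have "F = (\<lambda>h. h \<bullet> (\<Sum>b\<in>Basis. F b *\<^sub>R b))" by (rule ext)
  with F have "GDERIV \<phi> x :> (\<Sum>b\<in>Basis. F b *\<^sub>R b)"
    unfolding gderiv_def by (rule has_derivative_eq_rhs)
  moreover have "D = D'" if "GDERIV \<phi> x :> D" "GDERIV \<phi> x :> D'" for D D'
  proof -
    have "(\<lambda>h. h \<bullet> D) = (\<lambda>h. h \<bullet> D')"
      using that unfolding gderiv_def by (rule has_derivative_unique)
    then show ?thesis unfolding fun_eq_iff vector_eq_ldot .
  qed
  ultimately have "\<exists>!D. GDERIV \<phi> x :> D" by blast
  then show ?thesis
    unfolding grad_def by (rule theI')
qed

lemma C1_compact_support_imp_measurable:
  fixes \<phi> :: "'a::euclidean_space \<Rightarrow> real"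
  assumes "C1_compact_support \<phi>"
  shows "\<phi> \<in> borel_measurable borel" "grad \<phi> \<in> borel_measurable borel"
proof -
  have "continuous_on UNIV \<phi>"
    using assms by (meson C1_compact_support_def continuous_at_imp_continuous_on
        differentiable_imp_continuous_within)
  then show "\<phi> \<in> borel_measurable borel"
    by (rule borel_measurable_continuous_onI)
  show "grad \<phi> \<in> borel_measurable borel"
    using assms by (auto simp: C1_compact_support_def intro: borel_measurable_continuous_onI)
qed

text \<open>The Hardy inequality at the origin is applied to the translate
  \<open>\<lambda>x. \<phi> (w + x)\<close>, whose gradient is the translated gradient and whose
  support stays bounded; Lebesgue measure is translation invariant.\<close>

lemma hardy_weighted_C1_compact_support:
  fixes \<phi> :: "'a::euclidean_space \<Rightarrow> real"
  assumes "real DIM('a) + \<gamma> > 0" and C1: "C1_compact_support \<phi>"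
  shows "ennreal ((real DIM('a) + \<gamma>)\<^sup>2) *
      (\<integral>\<^sup>+ v. ennreal (norm (v - w) powr \<gamma>) * ennreal ((\<phi> v)\<^sup>2) \<partial>lborel)
    \<le> 4 * (\<integral>\<^sup>+ v. ennreal (norm (v - w) powr (2 + \<gamma>)) * ennreal ((norm (grad \<phi> v))\<^sup>2) \<partial>lborel)"
proof -
  have der: "GDERIV \<phi> x :> grad \<phi> x" and cont: "continuous_on UNIV (grad \<phi>)" for x
    using C1 by (auto simp: C1_compact_support_def intro: GDERIV_grad)
  note [measurable] = C1_compact_support_imp_measurable[OF C1]
  have "bounded {x. \<phi> x \<noteq> 0}"
    using C1 unfolding C1_compact_support_def
    by (metis bounded_subset closure_subset compact_imp_bounded)
  then have "bounded ((\<lambda>x. - w + x) ` {x. \<phi> x \<noteq> 0})"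
    by (rule bounded_translation)
  moreover have "{x. \<phi> (w + x) \<noteq> 0} \<subseteq> (\<lambda>x. - w + x) ` {x. \<phi> x \<noteq> 0}"
    by (auto intro!: image_eqI[where x = "w + _"])
  ultimately have bdd: "bounded {x. \<phi> (w + x) \<noteq> 0}"
    using bounded_subset by blast
  have der': "GDERIV (\<lambda>x. \<phi> (w + x)) x :> grad \<phi> (w + x)" for x
  proof -
    have "((\<lambda>x. w + x) has_derivative (\<lambda>h. h)) (at x)"
      by (auto intro!: derivative_eq_intros)
    then show ?thesis
      using der[of "w + x"] unfolding gderiv_def by (rule has_derivative_compose)
  qed
  have cont': "continuous_on UNIV (\<lambda>x. grad \<phi> (w + x))"
    by (intro continuous_on_compose2[OF cont] continuous_intros) auto
  have shift: "(\<integral>\<^sup>+ v. ennreal (norm (v - w) powr p) * ennreal ((g v)\<^sup>2) \<partial>lborel)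
      = (\<integral>\<^sup>+ x. ennreal (norm x powr p * (g (w + x))\<^sup>2) \<partial>lborel)"
    if [measurable]: "g \<in> borel_measurable borel" for p and g :: "'a \<Rightarrow> real"
    by (subst nn_integral_lborel_affine[of _ 1 w]) (auto simp: ennreal_mult)
  show ?thesis
    using hardy_weighted[OF assms(1) der' cont' bdd] by (simp add: shift)
qed

section \<open>Integrating the Hardy inequality against the density \<open>f\<close>\<close>

lemma riesz_potential_measurable [measurable]:
  fixes f :: "'a::euclidean_space \<Rightarrow> real"
  assumes [measurable]: "f \<in> borel_measurable borel"
  shows "h_pot \<gamma> f \<in> borel_measurable borel" "a_pot \<gamma> f \<in> borel_measurable borel"
proof -
  show "h_pot \<gamma> f \<in> borel_measurable borel"
    unfolding h_pot_def[abs_def] by measurable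
  show "a_pot \<gamma> f \<in> borel_measurable borel"
    unfolding a_pot_def[abs_def] by measurable
qed

text \<open>Tonelli turns the potential tested against \<open>g\<close> into an average over the
  centres \<open>w\<close> of weighted integrals, the form to which the Hardy inequality with centre
  \<open>w\<close> applies. It serves both \<open>h_pot\<close> and \<open>a_pot\<close>.\<close>

lemma nn_integral_riesz_potential:
  fixes f :: "'a::euclidean_space \<Rightarrow> real" and g :: "'a \<Rightarrow> ennreal"
  assumes [measurable]: "f \<in> borel_measurable borel" "g \<in> borel_measurable borel"
  shows "(\<integral>\<^sup>+ v. (c * (\<integral>\<^sup>+ w. ennreal (norm (v - w) powr p * f w) \<partial>lborel)) * g v \<partial>lborel)
    = c * (\<integral>\<^sup>+ w. ennreal (f w) * (\<integral>\<^sup>+ v. ennreal (norm (v - w) powr p) * g v \<partial>lborel) \<partial>lborel)"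
proof -
  \<comment> \<open>The first factor is non-negative, so \<open>ennreal\<close> splits the product;
    a negative \<open>f w\<close> would make both sides 0.\<close>
  have integrand: "ennreal (norm (v - w) powr p * f w) * g v
      = ennreal (f w) * (ennreal (norm (v - w) powr p) * g v)" for v w
    by (subst ennreal_mult') (auto simp: mult_ac)
  have "(\<integral>\<^sup>+ v. (c * (\<integral>\<^sup>+ w. ennreal (norm (v - w) powr p * f w) \<partial>lborel)) * g v \<partial>lborel)
    = c * (\<integral>\<^sup>+ v. (\<integral>\<^sup>+ w. ennreal (norm (v - w) powr p * f w) \<partial>lborel) * g v \<partial>lborel)"
    by (subst nn_integral_cmult[symmetric]) (auto simp: mult.assoc)
  also have "(\<integral>\<^sup>+ v. (\<integral>\<^sup>+ w. ennreal (norm (v - w) powr p * f w) \<partial>lborel) * g v \<partial>lborel)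
    = (\<integral>\<^sup>+ v. \<integral>\<^sup>+ w. ennreal (norm (v - w) powr p * f w) * g v \<partial>lborel \<partial>lborel)"
    by (subst nn_integral_multc) auto
  also have "\<dots> = (\<integral>\<^sup>+ w. \<integral>\<^sup>+ v. ennreal (norm (v - w) powr p * f w) * g v \<partial>lborel \<partial>lborel)"
    by (rule lborel_pair.Fubini') measurable
  also have "\<dots> = (\<integral>\<^sup>+ w. ennreal (f w) *
      (\<integral>\<^sup>+ v. ennreal (norm (v - w) powr p) * g v \<partial>lborel) \<partial>lborel)"
    by (subst nn_integral_cmult[symmetric])
      (auto simp: integrand)
  finally show ?thesis .
qed

lemma riesz_C_pos:
  assumes "0 < \<alpha>" "\<alpha> < real d"
  shows "riesz_C d \<alpha> > 0"
  using assms by (simp add: riesz_C_def Gamma_real_pos)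

text \<open>With \<open>k = d + \<gamma>\<close>, the constant of \<open>h_pot\<close> is
  \<open>k\<close> times the constant of \<open>a_pot\<close>. The extra factor \<open>k\<close> on
  the left therefore produces \<open>k\<^sup>2\<close>, exactly the constant of the Hardy
  inequality, which is then integrated over the centres.\<close>

lemma h_pot_le_a_pot_C1_compact_support:
  fixes f :: "'a::euclidean_space \<Rightarrow> real"
  assumes "- real DIM('a) < \<gamma>" "\<gamma> < 0"
    and [measurable]: "f \<in> borel_measurable borel" and C1: "C1_compact_support \<phi>"
  shows "ennreal (real DIM('a) + \<gamma>) *
      (\<integral>\<^sup>+ v. h_pot \<gamma> f v * ennreal ((\<phi> v)\<^sup>2) \<partial>lborel)
    \<le> 4 * (\<integral>\<^sup>+ v. a_pot \<gamma> f v * ennreal ((norm (grad \<phi> v))\<^sup>2) \<partial>lborel)"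
proof -
  note [measurable] = C1_compact_support_imp_measurable[OF C1]
  define k where "k = real DIM('a) + \<gamma>"
  define C where "C = landau_c DIM('a) \<gamma>"
  have "k > 0" using assms by (simp add: k_def)
  \<comment> \<open>Here \<open>- d < \<gamma> < 0\<close> places \<open>k\<close> strictly between
    0 and \<open>d\<close>, so both Gamma arguments are positive. Positivity is what later allows
    \<open>ennreal (C * k)\<close> to be split.\<close>
  have "riesz_C DIM('a) k > 0" using assms by (intro riesz_C_pos) (auto simp: k_def)
  then have "C > 0" and RC: "riesz_C DIM('a) k = C * k"
    using \<open>k > 0\<close> by (auto simp: C_def landau_c_def k_def)
  define X where "X w = (\<integral>\<^sup>+ v. ennreal (norm (v - w) powr \<gamma>) * ennreal ((\<phi> v)\<^sup>2) \<partial>lborel)" for w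
  define Y where "Y w = (\<integral>\<^sup>+ v. ennreal (norm (v - w) powr (2 + \<gamma>)) *
      ennreal ((norm (grad \<phi> v))\<^sup>2) \<partial>lborel)" for w
  have [measurable]: "X \<in> borel_measurable borel" "Y \<in> borel_measurable borel"
    unfolding X_def[abs_def] Y_def[abs_def] by measurable
  have XY: "ennreal (k\<^sup>2) * X w \<le> 4 * Y w" for w
    unfolding X_def Y_def k_def
    using \<open>k > 0\<close> C1 by (intro hardy_weighted_C1_compact_support) (auto simp: k_def)
  have "ennreal (k\<^sup>2) * (\<integral>\<^sup>+ w. ennreal (f w) * X w \<partial>lborel)
     = (\<integral>\<^sup>+ w. ennreal (f w) * (ennreal (k\<^sup>2) * X w) \<partial>lborel)"
    by (subst nn_integral_cmult[symmetric]) (auto simp: mult_ac)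
  also have "\<dots> \<le> (\<integral>\<^sup>+ w. ennreal (f w) * (4 * Y w) \<partial>lborel)"
    by (intro nn_integral_mono mult_left_mono XY) simp
  also have "\<dots> = 4 * (\<integral>\<^sup>+ w. ennreal (f w) * Y w \<partial>lborel)"
    by (subst nn_integral_cmult[symmetric]) (auto simp: mult_ac)
  finally have XY': "ennreal (k\<^sup>2) * (\<integral>\<^sup>+ w. ennreal (f w) * X w \<partial>lborel)
     \<le> 4 * (\<integral>\<^sup>+ w. ennreal (f w) * Y w \<partial>lborel)" .
  have "ennreal k * (\<integral>\<^sup>+ v. h_pot \<gamma> f v * ennreal ((\<phi> v)\<^sup>2) \<partial>lborel)
     = ennreal k * (ennreal (C * k) * (\<integral>\<^sup>+ w. ennreal (f w) * X w \<partial>lborel))"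
    unfolding h_pot_def X_def
    by (subst nn_integral_riesz_potential) (auto simp: RC k_def[symmetric])
  also have "\<dots> = ennreal C * (ennreal (k\<^sup>2) * (\<integral>\<^sup>+ w. ennreal (f w) * X w \<partial>lborel))"
    using \<open>k > 0\<close> \<open>C > 0\<close> by (simp add: ennreal_mult power2_eq_square mult_ac)
  also have "\<dots> \<le> ennreal C * (4 * (\<integral>\<^sup>+ w. ennreal (f w) * Y w \<partial>lborel))"
    using XY' by (rule mult_left_mono) simp
  also have "\<dots> = 4 * (ennreal C * (\<integral>\<^sup>+ w. ennreal (f w) * Y w \<partial>lborel))"
    by (simp add: mult_ac)
  also have "ennreal C * (\<integral>\<^sup>+ w. ennreal (f w) * Y w \<partial>lborel)
     = (\<integral>\<^sup>+ v. a_pot \<gamma> f v * ennreal ((norm (grad \<phi> v))\<^sup>2) \<partial>lborel)"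
    unfolding a_pot_def Y_def C_def by (subst nn_integral_riesz_potential) auto
  finally show ?thesis by (simp add: k_def)
qed

section \<open>Passage to limits\<close>

text \<open>Young's inequality for the cross term \<open>2 * (x \<bullet> y)\<close>, weighted so
  that the coefficient at \<open>x\<close> can be brought arbitrarily close to 1 at the expense of
  the one at \<open>y\<close>.\<close>

lemma norm_add_power2_le:
  fixes x y :: "'a::real_inner"
  assumes "\<epsilon> > 0"
  shows "(norm (x + y))\<^sup>2 \<le> (1 + \<epsilon>) * (norm x)\<^sup>2 + (1 + 1 / \<epsilon>) * (norm y)\<^sup>2"
proof -
  have "0 \<le> (norm (\<epsilon> *\<^sub>R x - y))\<^sup>2 / \<epsilon>" using assms by simp
  also have "\<dots> = \<epsilon> * (norm x)\<^sup>2 + (norm y)\<^sup>2 / \<epsilon> - 2 * (x \<bullet> y)"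
    using assms unfolding power2_norm_eq_inner
    by (simp add: inner_simps inner_commute field_simps)
  finally show ?thesis
    unfolding power2_norm_eq_inner by (simp add: inner_simps inner_commute algebra_simps)
qed

text \<open>Writing \<open>H n\<close> as \<open>G + (H n - G)\<close>, Young's inequality bounds
  each integral by \<open>1 + \<epsilon>\<close> times the limit energy plus a finite multiple of
  the vanishing error; then \<epsilon> tends to 0. The energies may be infinite. A bound on the
  lower limit is what has to follow Fatou's lemma.\<close>

lemma liminf_nn_integral_norm_power2_le:
  fixes G :: "'a \<Rightarrow> 'b::euclidean_space" and H :: "nat \<Rightarrow> 'a \<Rightarrow> 'b"
  assumes [measurable]: "A \<in> borel_measurable M" "G \<in> borel_measurable M"
      "\<And>n. H n \<in> borel_measurable M"
    and lim: "(\<lambda>n. \<integral>\<^sup>+ v. A v * ennreal ((norm (H n v - G v))\<^sup>2) \<partial>M) \<longlonglongrightarrow> 0"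
  shows "liminf (\<lambda>n. \<integral>\<^sup>+ v. A v * ennreal ((norm (H n v))\<^sup>2) \<partial>M)
    \<le> (\<integral>\<^sup>+ v. A v * ennreal ((norm (G v))\<^sup>2) \<partial>M)" (is "?L \<le> ?E")
proof -
  have bound: "?L \<le> ennreal (1 + \<epsilon>) * ?E" if "\<epsilon> > 0" for \<epsilon>
  proof -
    let ?d = "\<lambda>n. \<integral>\<^sup>+ v. A v * ennreal ((norm (H n v - G v))\<^sup>2) \<partial>M"
    have "(\<integral>\<^sup>+ v. A v * ennreal ((norm (H n v))\<^sup>2) \<partial>M)
        \<le> ennreal (1 + \<epsilon>) * ?E + ennreal (1 + 1 / \<epsilon>) * ?d n" for n
    proof -
      have "(\<integral>\<^sup>+ v. A v * ennreal ((norm (H n v))\<^sup>2) \<partial>M)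
        \<le> (\<integral>\<^sup>+ v. ennreal (1 + \<epsilon>) * (A v * ennreal ((norm (G v))\<^sup>2)) +
             ennreal (1 + 1 / \<epsilon>) * (A v * ennreal ((norm (H n v - G v))\<^sup>2)) \<partial>M)"
      proof (rule nn_integral_mono)
        fix v
        have "ennreal ((norm (H n v))\<^sup>2) \<le> ennreal ((1 + \<epsilon>) * (norm (G v))\<^sup>2 +
            (1 + 1 / \<epsilon>) * (norm (H n v - G v))\<^sup>2)"
          using norm_add_power2_le[OF \<open>\<epsilon> > 0\<close>, of "G v" "H n v - G v"] by (intro ennreal_leI) simp
        also have "\<dots> = ennreal (1 + \<epsilon>) * ennreal ((norm (G v))\<^sup>2) +
            ennreal (1 + 1 / \<epsilon>) * ennreal ((norm (H n v - G v))\<^sup>2)"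
          using \<open>\<epsilon> > 0\<close> by (simp add: ennreal_mult[symmetric] ennreal_plus[symmetric] del: ennreal_plus)
        finally have "A v * ennreal ((norm (H n v))\<^sup>2) \<le> A v * (ennreal (1 + \<epsilon>) * ennreal ((norm (G v))\<^sup>2) +
            ennreal (1 + 1 / \<epsilon>) * ennreal ((norm (H n v - G v))\<^sup>2))"
          by (rule mult_left_mono) simp
        then show "A v * ennreal ((norm (H n v))\<^sup>2)
          \<le> ennreal (1 + \<epsilon>) * (A v * ennreal ((norm (G v))\<^sup>2)) +
             ennreal (1 + 1 / \<epsilon>) * (A v * ennreal ((norm (H n v - G v))\<^sup>2))"
          by (simp only: distrib_left mult.left_commute)
      qed
      also have "\<dots> = ennreal (1 + \<epsilon>) * ?E + ennreal (1 + 1 / \<epsilon>) * ?d n"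
        by (simp add: nn_integral_add nn_integral_cmult del: ennreal_plus)
      finally show ?thesis .
    qed
    then have "?L \<le> liminf (\<lambda>n. ennreal (1 + \<epsilon>) * ?E + ennreal (1 + 1 / \<epsilon>) * ?d n)"
      by (intro Liminf_mono) auto
    also have "(\<lambda>n. ennreal (1 + \<epsilon>) * ?E + ennreal (1 + 1 / \<epsilon>) * ?d n)
        \<longlonglongrightarrow> ennreal (1 + \<epsilon>) * ?E + ennreal (1 + 1 / \<epsilon>) * 0"
      by (intro tendsto_add tendsto_const ennreal_tendsto_cmult lim) simp
    then have "liminf (\<lambda>n. ennreal (1 + \<epsilon>) * ?E + ennreal (1 + 1 / \<epsilon>) * ?d n) = ennreal (1 + \<epsilon>) * ?E"
      by (subst lim_imp_Liminf) auto
    finally show ?thesis .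
  qed
  \<comment> \<open>The second factor tends to 1, which is neither 0 nor infinite, so the product
    converges even if \<open>?E\<close> is infinite.\<close>
  have "((\<lambda>\<epsilon>. ?E * ennreal (1 + \<epsilon>)) \<longlongrightarrow> ?E * ennreal (1 + 0)) (at_right 0)"
    by (intro tendsto_mult_ennreal tendsto_ennrealI tendsto_intros) auto
  then have "?L \<le> ?E * ennreal (1 + 0)"
    by (rule tendsto_lowerbound)
      (auto simp: eventually_at_right_less mult.commute simp del: ennreal_plus
        intro!: bound eventually_at_rightI[of 0 1])
  then show ?thesis by simp
qed

theorem lemma2p1:
  fixes f :: "'a::euclidean_space \<Rightarrow> real" and \<gamma> :: real
  assumes "DIM('a) \<ge> 3"
    and "- real DIM('a) < \<gamma>" and "\<gamma> < -2"
    and "integrable lborel f" and "AE v in lborel. 0 \<le> f v"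
  shows "(\<forall>\<phi>. C1_compact_support \<phi> \<longrightarrow>
            ennreal (real DIM('a) + \<gamma>) *
              (\<integral>\<^sup>+ v. h_pot \<gamma> f v * ennreal ((\<phi> v)\<^sup>2) \<partial>lborel)
            \<le> 4 * (\<integral>\<^sup>+ v. a_pot \<gamma> f v * ennreal ((norm (grad \<phi> v))\<^sup>2) \<partial>lborel)) \<and>
         (\<forall>\<phi> G. C1_compact_support_limit \<gamma> f \<phi> G \<longrightarrow>
            ennreal (real DIM('a) + \<gamma>) *
              (\<integral>\<^sup>+ v. h_pot \<gamma> f v * ennreal ((\<phi> v)\<^sup>2) \<partial>lborel)
            \<le> 4 * (\<integral>\<^sup>+ v. a_pot \<gamma> f v * ennreal ((norm (G v))\<^sup>2) \<partial>lborel))"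
proof (intro conjI allI impI)
  have [measurable]: "f \<in> borel_measurable borel"
    using assms(4) by auto
  show C1: "ennreal (real DIM('a) + \<gamma>) * (\<integral>\<^sup>+ v. h_pot \<gamma> f v * ennreal ((\<phi> v)\<^sup>2) \<partial>lborel)
      \<le> 4 * (\<integral>\<^sup>+ v. a_pot \<gamma> f v * ennreal ((norm (grad \<phi> v))\<^sup>2) \<partial>lborel)"
    if "C1_compact_support \<phi>" for \<phi>
    using assms that by (intro h_pot_le_a_pot_C1_compact_support) auto
  fix \<phi> G assume "C1_compact_support_limit \<gamma> f \<phi> G"
  then obtain \<psi> :: "nat \<Rightarrow> 'a \<Rightarrow> real"
    where [measurable]: "\<phi> \<in> borel_measurable borel" "G \<in> borel_measurable borel"
      and \<psi>: "\<And>n. C1_compact_support (\<psi> n)"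
      and ae: "AE v in lborel. (\<lambda>n. \<psi> n v) \<longlonglongrightarrow> \<phi> v"
      and lim: "(\<lambda>n. \<integral>\<^sup>+ v. a_pot \<gamma> f v * ennreal ((norm (grad (\<psi> n) v - G v))\<^sup>2) \<partial>lborel)
          \<longlonglongrightarrow> 0"
    unfolding C1_compact_support_limit_def by blast
  note [measurable] = C1_compact_support_imp_measurable[OF \<psi>]
  define k where "k = ennreal (real DIM('a) + \<gamma>)"
  have "k * (\<integral>\<^sup>+ v. h_pot \<gamma> f v * ennreal ((\<phi> v)\<^sup>2) \<partial>lborel)
      = (\<integral>\<^sup>+ v. k * h_pot \<gamma> f v * ennreal ((\<phi> v)\<^sup>2) \<partial>lborel)"
    by (subst nn_integral_cmult[symmetric]) (auto simp: mult.assoc)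
  also have "\<dots> \<le> (\<integral>\<^sup>+ v. liminf (\<lambda>n. k * h_pot \<gamma> f v * ennreal ((\<psi> n v)\<^sup>2)) \<partial>lborel)"
  proof (rule nn_integral_mono_AE, use ae in eventually_elim)
    case (elim v)
    \<comment> \<open>The product need not converge where \<open>h[f] = \<infinity>\<close> and \<open>\<phi> = 0\<close>; only the lower bound is needed.\<close>
    show ?case
    proof (cases "\<phi> v = 0")
      case False
      have "(\<lambda>n. ennreal ((\<psi> n v)\<^sup>2)) \<longlonglongrightarrow> ennreal ((\<phi> v)\<^sup>2)"
        by (intro tendsto_ennrealI tendsto_power elim)
      then have "(\<lambda>n. k * h_pot \<gamma> f v * ennreal ((\<psi> n v)\<^sup>2))
          \<longlonglongrightarrow> k * h_pot \<gamma> f v * ennreal ((\<phi> v)\<^sup>2)"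
        using False by (intro tendsto_mult_ennreal tendsto_const) auto
      then show ?thesis by (subst lim_imp_Liminf) auto
    qed simp
  qed
  also have "\<dots> \<le> liminf (\<lambda>n. \<integral>\<^sup>+ v. k * h_pot \<gamma> f v * ennreal ((\<psi> n v)\<^sup>2) \<partial>lborel)"
    by (rule nn_integral_liminf) measurable
  also have "\<dots> = liminf (\<lambda>n. k * (\<integral>\<^sup>+ v. h_pot \<gamma> f v * ennreal ((\<psi> n v)\<^sup>2) \<partial>lborel))"
    by (subst nn_integral_cmult[symmetric]) (auto simp: mult.assoc)
  \<comment> \<open>The inequality already shown holds for every \<open>\<psi> n\<close>. The factor
    4 is absorbed into the weight, so that \<open>4 * a_pot \<gamma> f v\<close> serves as the
    weight \<open>A\<close> of the semicontinuity lemma.\<close>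
  also have "\<dots> \<le> liminf (\<lambda>n. \<integral>\<^sup>+ v. 4 * a_pot \<gamma> f v * ennreal ((norm (grad (\<psi> n) v))\<^sup>2) \<partial>lborel)"
    using C1[OF \<psi>]
    by (intro Liminf_mono) (auto simp: k_def mult.assoc nn_integral_cmult)
  also have "\<dots> \<le> (\<integral>\<^sup>+ v. 4 * a_pot \<gamma> f v * ennreal ((norm (G v))\<^sup>2) \<partial>lborel)"
  proof (rule liminf_nn_integral_norm_power2_le)
    show "(\<lambda>n. \<integral>\<^sup>+ v. 4 * a_pot \<gamma> f v * ennreal ((norm (grad (\<psi> n) v - G v))\<^sup>2) \<partial>lborel)
        \<longlonglongrightarrow> 0"
      using ennreal_tendsto_cmult[OF _ lim, of 4]
      by (simp add: mult.assoc nn_integral_cmult)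
  qed measurable
  also have "\<dots> = 4 * (\<integral>\<^sup>+ v. a_pot \<gamma> f v * ennreal ((norm (G v))\<^sup>2) \<partial>lborel)"
    by (subst nn_integral_cmult[symmetric]) (auto simp: mult.assoc)
  finally show "ennreal (real DIM('a) + \<gamma>) * (\<integral>\<^sup>+ v. h_pot \<gamma> f v * ennreal ((\<phi> v)\<^sup>2) \<partial>lborel)
      \<le> 4 * (\<integral>\<^sup>+ v. a_pot \<gamma> f v * ennreal ((norm (G v))\<^sup>2) \<partial>lborel)"
    by (simp add: k_def)
qed

end
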